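(* Let $\gamma_{\mathrm{ref}}\in\mathbb{R}$. For every $\delta>0$, one can find a probability measure $P$ in the neighborhood $\{P : D_1(P,G_{\gamma_{\mathrm{ref}}})\le\delta\}$, along with positive constants ($c_+$ and $x_+$, or $c_0$ and $x_0$, or $c_-$ and $\epsilon_-$, according to the case) such that: a) if $\gamma_{\mathrm{ref}}>0$, then $P(x,\infty)\ge c_+\log^{-3}x$ for every $x>x_+$; b) if $\gamma_{\mathrm{ref}}=0$, then $P(x,\infty)\ge c_0\,x^{-1}\log^{-2}x$ for every $x>x_0$; c) if $\gamma_{\mathrm{ref}}<0$, then $P(-\infty,x_G^* )=1$ and $P(x_G^*-\epsilon,x_G^* )\ge c_-\log^{-3}\frac{1}{\epsilon}$ for every $0<\epsilon<\epsilon_-$, where the right endpoint $x_G^* = \sup\{x : G_{\gamma_{\mathrm{ref}}}(x)<1\}$ is finite because $\gamma_{\mathrm{ref}}<0$.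
   Context: For probability measures $P,Q$ on $(\mathbb{R},\mathcal{B}(\mathbb{R}))$ with $P$ absolutely continuous with respect to $Q$, the Kullback–Leibler divergence is $D_1(P,Q) := E_Q\left[\frac{dP}{dQ}\log\frac{dP}{dQ}\right]$ (with $0\log 0=0$); if $P$ is not absolutely continuous with respect to $Q$, then $D_1(P,Q):=\infty$. A distribution function is identified with the probability measure it induces on $\mathbb{R}$. The notation $\log^{-k}x$ means $(\log x)^{-k}$, and $P(a,b)$ denotes the $P$-probability of the interval $(a,b)$. For $\gamma\in\mathbb{R}$, the extreme value distribution is $G_\gamma(x) := \exp\left(-(1+\gamma x)^{-1/\gamma}\right)$ for $1+\gamma x>0$, interpreted as $\exp(-\exp(-x))$ when $\gamma=0$ (outside $\{1+\gamma x>0\}$, $G_\gamma$ is extended as a distribution function: $0$ if $\gamma>0$, $1$ if $\gamma<0$). *)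

theory Defs
  imports "HOL-Probability.Probability"
begin

text \<open>
  Expectation of a real function whose positive or negative part has finite integral, with values
  in the extended reals. The Bochner integral is unsuitable here: it is \<open>0\<close> for every
  non-integrable function, including those with expectation \<open>\<infinity>\<close>.
\<close>

definition ext_expectation :: "'a measure \<Rightarrow> ('a \<Rightarrow> real) \<Rightarrow> ereal" where
  "ext_expectation M f =
     enn2ereal (\<integral>\<^sup>+x. ennreal (f x) \<partial>M) - enn2ereal (\<integral>\<^sup>+x. ennreal (- f x) \<partial>M)"

text \<open>
  The derivative \<open>dP/dQ\<close> is \<open>RN_deriv Q P\<close>, finite \<open>Q\<close>-almost everywhere for a probability
  measure \<open>P\<close>. Since \<open>t * ln t\<close> is bounded below on \<open>t \<ge> 0\<close>, the subtrahend in
  \<open>ext_expectation\<close> is finite when \<open>Q\<close> is finite. The convention \<open>0 log 0 = 0\<close>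
  holds because \<open>ln 0 = 0\<close>. The library's \<open>KL_divergence\<close> is real-valued and hence cannot
  represent an infinite divergence.
\<close>

definition KL_div :: "real measure \<Rightarrow> real measure \<Rightarrow> ereal" where
  "KL_div P Q =
     (if absolutely_continuous Q P
      then ext_expectation Q (\<lambda>x. enn2real (RN_deriv Q P x) * ln (enn2real (RN_deriv Q P x)))
      else \<infinity>)"

definition gev_cdf :: "real \<Rightarrow> real \<Rightarrow> real" where
  "gev_cdf \<gamma> x =
     (if \<gamma> = 0 then exp (- exp (- x))
      else if 1 + \<gamma> * x > 0 then exp (- ((1 + \<gamma> * x) powr (- 1 / \<gamma>)))
      else if \<gamma> > 0 then 0 else 1)"

definition gev_measure :: "real \<Rightarrow> real measure" where
  "gev_measure \<gamma> = interval_measure (gev_cdf \<gamma>)"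

definition right_endpoint :: "(real \<Rightarrow> real) \<Rightarrow> ereal" where
  "right_endpoint F = (SUP x\<in>{x. F x < 1}. ereal x)"

end

theory Submission
  imports Defs "HOL-Real_Asymp.Real_Asymp"
begin

text \<open>
  Write \<open>Q\<close> for the extreme value distribution and \<open>G\<close> for its distribution function. If \<open>X\<close> has
  law \<open>Q\<close>, then \<open>- ln (- ln (G X))\<close> has the Gumbel distribution whatever \<open>\<gamma>\<close> is; its upper tail is
  about \<open>exp (- L)\<close>. Cut its values above \<open>1\<close> into the dyadic blocks
  \<open>A n = (2 ^ n, 2 ^ (n + 1)]\<close>, so that \<open>ln (1 / Q (A n)) \<le> 2 ^ n + 2\<close>.

  Let \<open>w n\<close> be the weights proportional to \<open>2 ^ (- n) / (n + 1)\<^sup>2\<close>, with sum \<open>1\<close>. The mixture of the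
  conditional laws \<open>Q (. | A n)\<close> with these weights has divergence at most
  \<open>\<Sum>n. w n * ln (1 / Q (A n))\<close> from \<open>Q\<close>, which is finite because its terms are \<open>O (1 / n\<^sup>2)\<close>.
  Mixing it with a proportion \<open>1 - \<eta>\<close> of \<open>Q\<close> itself makes the divergence \<open>O (\<eta>)\<close>, hence at most \<open>\<delta>\<close>
  for small \<open>\<eta>\<close> (lemma \<open>exists_close_measure_with_weights\<close>).

  The new law puts at least \<open>\<eta> * w n\<close> on \<open>A n\<close>. For \<open>L\<close> between \<open>2 ^ (n - 1)\<close> and \<open>2 ^ n\<close>, this is of
  order \<open>1 / (L * (ln L)\<^sup>2)\<close> (lemma \<open>exists_gev_neighbour_heavy_blocks\<close>). It remains to change
  variables. For \<open>\<gamma> = 0\<close>, \<open>L = x\<close> gives the claim. For \<open>\<gamma> > 0\<close> the level \<open>x\<close> is exceeded once \<open>L\<close> is a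
  suitable multiple of \<open>ln x\<close>, and for \<open>\<gamma> < 0\<close> the endpoint is within \<open>\<epsilon>\<close> once \<open>L\<close> is a suitable
  multiple of \<open>ln (1 / \<epsilon>)\<close>; in both cases the coarser bound \<open>1 / L ^ 3\<close> is enough.
\<close>

section \<open>Small tilts of a probability measure along disjoint sets\<close>

lemma suminf_indicator_disjoint:
  fixes a :: "nat \<Rightarrow> 'b :: real_normed_algebra_1"
  assumes "disjoint_family A" "x \<in> A n"
  shows "(\<Sum>i. a i * indicator (A i) x) = a n"
proof -
  have "x \<notin> A i" if "i \<noteq> n" for i
    using assms that by (auto simp: disjoint_family_on_def)
  then have "(\<Sum>i. a i * indicator (A i) x) = (\<Sum>i\<in>{n}. a i * indicator (A i) x)"
    by (intro suminf_finite) auto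
  then show ?thesis
    using assms by simp
qed

lemma nn_integral_step_function:
  fixes \<phi> :: "real \<Rightarrow> real" and a :: "nat \<Rightarrow> real"
  assumes A: "disjoint_family A" "\<And>n. A n \<in> sets M" and "\<phi> 0 = 0"
  shows "(\<integral>\<^sup>+x. ennreal (\<phi> (\<Sum>n. a n * indicator (A n) x)) \<partial>M) =
           (\<Sum>n. ennreal (\<phi> (a n)) * emeasure M (A n))"
proof -
  have "ennreal (\<phi> (\<Sum>n. a n * indicator (A n) x)) = (\<Sum>n. ennreal (\<phi> (a n)) * indicator (A n) x)" for x
  proof (cases "\<exists>n. x \<in> A n")
    case True
    then obtain n where n: "x \<in> A n" by blast
    then have "x \<notin> A i" if "i \<noteq> n" for i
      using A(1) that by (auto simp: disjoint_family_on_def)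
    then have "(\<Sum>i. ennreal (\<phi> (a i)) * indicator (A i) x) = (\<Sum>i\<in>{n}. ennreal (\<phi> (a i)) * indicator (A i) x)"
      by (intro suminf_finite) auto
    then show ?thesis
      using n by (simp add: suminf_indicator_disjoint[OF A(1) n])
  qed (use assms in simp)
  then have "(\<integral>\<^sup>+x. ennreal (\<phi> (\<Sum>n. a n * indicator (A n) x)) \<partial>M) =
      (\<integral>\<^sup>+x. (\<Sum>n. ennreal (\<phi> (a n)) * indicator (A n) x) \<partial>M)"
    by simp
  also have "\<dots> = (\<Sum>n. \<integral>\<^sup>+x. ennreal (\<phi> (a n)) * indicator (A n) x \<partial>M)"
    using A by (intro nn_integral_suminf) auto
  also have "\<dots> = (\<Sum>n. ennreal (\<phi> (a n)) * emeasure M (A n))"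
    using A by (simp add: nn_integral_cmult_indicator)
  finally show ?thesis .
qed

text \<open>
  Here \<open>1 - \<eta> + \<eta> * r\<close> is the value of the density of the mixture with respect to the reference
  measure. The bound is linear in \<open>\<eta>\<close> and vanishes where \<open>r = 0\<close>: there the density is below \<open>1\<close>, so
  that the left side is not positive.
\<close>
lemma mixture_entropy_bound:
  fixes r \<eta> :: real
  assumes "0 \<le> r" "0 < \<eta>" "\<eta> < 1"
  shows "(1 - \<eta> + \<eta> * r) * ln (1 - \<eta> + \<eta> * r) \<le> \<eta> * (r * (1 + max 0 (ln r)))"
proof (cases "r \<ge> 1")
  case True
  define t where "t = 1 - \<eta> + \<eta> * r"
  have t1: "t - 1 = \<eta> * (r - 1)"
    by (simp add: t_def algebra_simps)
  then have "1 \<le> t"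
    using assms True by (smt (verit) mult_nonneg_nonneg)
  have "r - t = (1 - \<eta>) * (r - 1)"
    by (simp add: t_def algebra_simps)
  then have "t \<le> r"
    using assms True by (smt (verit) mult_nonneg_nonneg)
  have "(1 - \<eta>) * ln t \<le> 1 * (\<eta> * r)"
  proof (rule mult_mono)
    have "ln t \<le> t - 1"
      using \<open>1 \<le> t\<close> by (intro ln_le_minus_one) auto
    also have "\<dots> \<le> \<eta> * r"
      using assms by (simp add: t1 algebra_simps)
    finally show "ln t \<le> \<eta> * r" .
  qed (use assms \<open>1 \<le> t\<close> in auto)
  moreover have "\<eta> * r * ln t \<le> \<eta> * r * max 0 (ln r)"
    using assms True \<open>1 \<le> t\<close> \<open>t \<le> r\<close> by (intro mult_left_mono) (auto simp: max_def)
  moreover have "t * ln t = (1 - \<eta>) * ln t + \<eta> * r * ln t"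
    by (simp add: t_def algebra_simps)
  ultimately show ?thesis
    unfolding t_def[symmetric] by (simp add: algebra_simps)
next
  case False
  define t where "t = 1 - \<eta> + \<eta> * r"
  have "0 < t"
    using assms by (simp add: t_def add_pos_nonneg)
  moreover have "\<eta> * r \<le> \<eta> * 1"
    using assms False by (intro mult_left_mono) auto
  then have "t \<le> 1"
    by (simp add: t_def)
  ultimately have "t * ln t \<le> 0"
    by (simp add: mult_nonneg_nonpos)
  also have "0 \<le> \<eta> * (r * (1 + max 0 (ln r)))"
    using assms by auto
  finally show ?thesis
    by (simp add: t_def)
qed

text \<open>
  Only the positive part of \<open>f * ln f\<close> has to be controlled, since \<open>ennreal\<close> truncates negative
  values to \<open>0\<close> and the integral of the negative part is subtracted in the divergence.
\<close>
lemma KL_div_density_le: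
  assumes Q: "prob_space Q" and f[measurable]: "f \<in> borel_measurable Q"
    and f0: "\<And>x. 0 \<le> f x"
    and le: "(\<integral>\<^sup>+x. ennreal (f x * ln (f x)) \<partial>Q) \<le> ennreal d" and "0 \<le> d"
  shows "KL_div (density Q (\<lambda>x. ennreal (f x))) Q \<le> ereal d"
proof -
  interpret prob_space Q by fact
  let ?P = "density Q (\<lambda>x. ennreal (f x))"
  let ?g = "\<lambda>x. enn2real (RN_deriv Q ?P x)"
  have "AE x in Q. ennreal (f x) = RN_deriv Q ?P x"
    by (intro RN_deriv_unique) auto
  then have "AE x in Q. ?g x = f x"
    by eventually_elim (metis enn2real_ennreal f0)
  then have "(\<integral>\<^sup>+x. ennreal (?g x * ln (?g x)) \<partial>Q) = (\<integral>\<^sup>+x. ennreal (f x * ln (f x)) \<partial>Q)"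
    by (intro nn_integral_cong_AE) auto
  then have "enn2ereal (\<integral>\<^sup>+x. ennreal (?g x * ln (?g x)) \<partial>Q) \<le> ereal d"
    using le \<open>0 \<le> d\<close> by (metis enn2ereal_ennreal less_eq_ennreal.rep_eq)
  moreover have "absolutely_continuous Q ?P"
    by (intro absolutely_continuousI_density) auto
  ultimately show ?thesis
    unfolding KL_div_def ext_expectation_def
    by (simp add: ereal_diff_le_mono_left)
qed

text \<open>
  Finiteness of \<open>\<Sum>n. w n * ln (1 / Q (A n))\<close> is what allows mass proportional to \<open>w n\<close> to be put on
  \<open>A n\<close> at an arbitrarily small cost in divergence.
\<close>
lemma exists_close_measure_with_weights:
  fixes Q :: "real measure" and A :: "nat \<Rightarrow> real set" and w :: "nat \<Rightarrow> real"
  assumes Q: "prob_space Q" "sets Q = sets borel"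
    and A: "disjoint_family A" "\<And>n. A n \<in> sets borel"
    and q: "\<And>n. 0 < measure Q (A n)"
    and w: "\<And>n. 0 \<le> w n" "w sums 1"
    and wq: "summable (\<lambda>n. w n * ln (1 / measure Q (A n)))"
    and "\<delta> > 0"
  shows "\<exists>P \<eta>. prob_space P \<and> sets P = sets borel \<and> absolutely_continuous Q P \<and>
    KL_div P Q \<le> ereal \<delta> \<and> 0 < \<eta> \<and> (\<forall>n. \<eta> * w n \<le> measure P (A n))"
proof -
  interpret prob_space Q by fact
  note [measurable_cong] = Q(2)
  note [measurable] = A(2)
  have A_Q: "A n \<in> sets Q" for n
    using A(2) Q(2) by simp
  define q where "q n = measure Q (A n)" for n
  have q01: "0 < q n" "q n \<le> 1" for n
    using q by (auto simp: q_def)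
  have eq: "emeasure Q (A n) = ennreal (q n)" for n
    by (simp add: q_def emeasure_eq_measure)
  define a where "a n = w n / q n" for n
  have a0: "0 \<le> a n" and aq: "a n * q n = w n" for n
    using w(1)[of n] q01[of n] by (auto simp: a_def)
  \<comment> \<open>the density of the mixture of the conditional laws on the sets \<open>A n\<close>\<close>
  define r where "r x = (\<Sum>n. a n * indicator (A n) x)" for x
  have r_meas[measurable]: "r \<in> borel_measurable Q"
    unfolding r_def by measurable
  have r_A: "r x = a n" if "x \<in> A n" for x n
    using that A(1) unfolding r_def by (rule suminf_indicator_disjoint[rotated])
  have r0: "0 \<le> r x" for x
  proof (cases "\<exists>n. x \<in> A n")
    case False
    then show ?thesis by (simp add: r_def)
  qed (use r_A a0 in auto)
  \<comment> \<open>\<open>S\<close> bounds the integral of \<open>r * (1 + max 0 (ln r))\<close>, so the divergence will be at most \<open>\<eta> * S\<close>\<close>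
  define S where "S = 1 + (\<Sum>n. w n * ln (1 / q n))"
  have lnq: "0 \<le> ln (1 / q n)" for n
    using q01[of n] by simp
  have sum_S: "(\<lambda>n. w n * (1 + ln (1 / q n))) sums S"
    using sums_add[OF w(2) summable_sums[OF wq]] unfolding S_def q_def by (simp add: distrib_left)
  have "1 \<le> S"
    unfolding S_def using w(1) lnq wq by (simp add: suminf_nonneg q_def)
  define \<eta> where "\<eta> = min (1/2) (\<delta> / S)"
  have \<eta>: "0 < \<eta>" "\<eta> < 1" "\<eta> * S \<le> \<delta>"
    using \<open>1 \<le> S\<close> \<open>\<delta> > 0\<close> by (auto simp: \<eta>_def min_def field_simps)
  define f where "f x = 1 - \<eta> + \<eta> * r x" for x
  have f_meas[measurable]: "f \<in> borel_measurable Q"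
    unfolding f_def by measurable
  have f0: "0 \<le> f x" for x
    using \<eta> r0[of x] by (simp add: f_def)
  define P where "P = density Q (\<lambda>x. ennreal (f x))"

  have int_r: "(\<integral>\<^sup>+x. ennreal (r x) \<partial>Q) = 1"
  proof -
    have "(\<integral>\<^sup>+x. ennreal (r x) \<partial>Q) = (\<Sum>n. ennreal (a n) * emeasure Q (A n))"
      unfolding r_def using nn_integral_step_function[OF A(1) A_Q, of "\<lambda>t. t" a] by simp
    also have "\<dots> = (\<Sum>n. ennreal (w n))"
      using a0 q01 aq by (simp add: eq less_imp_le flip: ennreal_mult)
    also have "\<dots> = 1"
      using suminf_ennreal_eq[OF w] by simp
    finally show ?thesis .
  qed
  have int_f: "(\<integral>\<^sup>+x. ennreal (f x) \<partial>Q) = 1"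
  proof -
    have "(\<integral>\<^sup>+x. ennreal (f x) \<partial>Q) = (\<integral>\<^sup>+x. ennreal (1 - \<eta>) + ennreal \<eta> * ennreal (r x) \<partial>Q)"
      using \<eta> r0 by (intro nn_integral_cong) (simp add: f_def ennreal_plus ennreal_mult)
    also have "\<dots> = ennreal (1 - \<eta>) + ennreal \<eta> * 1"
      by (simp add: nn_integral_add nn_integral_cmult int_r emeasure_space_1)
    also have "\<dots> = 1"
      using \<eta> by (simp flip: ennreal_plus)
    finally show ?thesis .
  qed
  have "prob_space P"
    unfolding P_def by (rule prob_spaceI) (simp add: emeasure_density int_f cong: nn_integral_cong)
  moreover have "KL_div P Q \<le> ereal \<delta>"
  proof -
    define \<phi> where "\<phi> t = t * (1 + max 0 (ln t))" for t :: real
    have \<phi>_meas[measurable]: "\<phi> \<in> borel_measurable borel"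
      unfolding \<phi>_def by measurable
    have \<phi>0: "0 \<le> \<phi> t" if "0 \<le> t" for t
      using that by (simp add: \<phi>_def)
    have w_le: "w n \<le> 1" for n
      using sum_le_suminf[of w "{n}"] w by (auto simp: sums_iff)
    have \<phi>_a: "ennreal (\<phi> (a n)) * emeasure Q (A n) \<le> ennreal (w n * (1 + ln (1 / q n)))" for n
    proof -
      \<comment> \<open>as \<open>w n \<le> 1\<close>, the density is at most \<open>1 / q n\<close> on \<open>A n\<close>\<close>
      have "max 0 (ln (a n)) \<le> ln (1 / q n)"
      proof (cases "w n = 0")
        case False
        then have "0 < w n" using w(1)[of n] by simp
        then have "a n \<le> 1 / q n" "0 < a n"
          using w_le[of n] q01[of n] by (auto simp: a_def divide_simps)
        then have "ln (a n) \<le> ln (1 / q n)"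
          using q01[of n] by (subst ln_le_cancel_iff) auto
        then show ?thesis
          using lnq[of n] by auto
      qed (use lnq[of n] in \<open>simp add: a_def\<close>)
      then have "w n * (1 + max 0 (ln (a n))) \<le> w n * (1 + ln (1 / q n))"
        using w(1) by (intro mult_left_mono) auto
      moreover have "\<phi> (a n) * q n = w n * (1 + max 0 (ln (a n)))"
        unfolding \<phi>_def aq[symmetric] by simp
      ultimately have "\<phi> (a n) * q n \<le> w n * (1 + ln (1 / q n))"
        by simp
      moreover have "ennreal (\<phi> (a n)) * emeasure Q (A n) = ennreal (\<phi> (a n) * q n)"
        using q01[of n] \<phi>0[OF a0] by (simp add: eq ennreal_mult)
      ultimately show ?thesis
        by (simp add: ennreal_leI)
    qed
    have "(\<integral>\<^sup>+x. ennreal (f x * ln (f x)) \<partial>Q) \<le> (\<integral>\<^sup>+x. ennreal \<eta> * ennreal (\<phi> (r x)) \<partial>Q)"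
    proof (intro nn_integral_mono)
      fix x
      have "f x * ln (f x) \<le> \<eta> * \<phi> (r x)"
        unfolding f_def \<phi>_def using mixture_entropy_bound[OF r0 \<eta>(1,2)] .
      then show "ennreal (f x * ln (f x)) \<le> ennreal \<eta> * ennreal (\<phi> (r x))"
        using \<eta>(1) \<phi>0[OF r0] by (simp add: ennreal_leI flip: ennreal_mult)
    qed
    also have "\<dots> = ennreal \<eta> * (\<integral>\<^sup>+x. ennreal (\<phi> (r x)) \<partial>Q)"
      by (intro nn_integral_cmult) measurable
    also have "(\<integral>\<^sup>+x. ennreal (\<phi> (r x)) \<partial>Q) = (\<Sum>n. ennreal (\<phi> (a n)) * emeasure Q (A n))"
      unfolding r_def by (intro nn_integral_step_function A A_Q) (simp add: \<phi>_def)
    also have "\<dots> \<le> (\<Sum>n. ennreal (w n * (1 + ln (1 / q n))))"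
      by (intro suminf_le \<phi>_a summableI)
    also have "\<dots> = ennreal S"
      by (rule suminf_ennreal_eq[OF _ sum_S]) (use w(1) lnq in \<open>simp add: add_nonneg_nonneg\<close>)
    also have "ennreal \<eta> * ennreal S = ennreal (\<eta> * S)"
      using \<eta> \<open>1 \<le> S\<close> by (simp add: ennreal_mult)
    also have "\<dots> \<le> ennreal \<delta>"
      using \<eta>(3) by (rule ennreal_leI)
    finally have "(\<integral>\<^sup>+x. ennreal (f x * ln (f x)) \<partial>Q) \<le> ennreal \<delta>"
      by (simp add: mult_left_mono)
    then show ?thesis
      unfolding P_def using Q(1) f0 \<open>\<delta> > 0\<close> by (intro KL_div_density_le) auto
  qed
  moreover have "\<eta> * w n \<le> measure P (A n)" for n
  proof -
    have "ennreal (\<eta> * w n) = ennreal (\<eta> * a n) * emeasure Q (A n)"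
      using \<eta> a0[of n] q01[of n] aq[of n] by (simp add: eq mult.assoc flip: ennreal_mult)
    also have "\<dots> = (\<integral>\<^sup>+x. ennreal (\<eta> * a n) * indicator (A n) x \<partial>Q)"
      using A_Q by (simp add: nn_integral_cmult_indicator)
    also have "\<dots> \<le> (\<integral>\<^sup>+x. ennreal (f x) * indicator (A n) x \<partial>Q)"
      using \<eta> by (intro nn_integral_mono) (auto simp: f_def r_A indicator_def intro!: ennreal_leI)
    also have "\<dots> = emeasure P (A n)"
      unfolding P_def using A_Q by (simp add: emeasure_density)
    finally have "ennreal (\<eta> * w n) \<le> ennreal (measure P (A n))"
      using \<open>prob_space P\<close> by (simp add: finite_measure.emeasure_eq_measure prob_space.finite_measure)
    then show ?thesis
      by simp
  qed
  moreover have "sets P = sets borel" "absolutely_continuous Q P"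
    unfolding P_def using Q(2) by (auto intro!: absolutely_continuousI_density)
  ultimately show ?thesis
    using \<eta>(1) by blast
qed

section \<open>The extreme value distribution on a log-survival scale\<close>

lemma gev_cdf_mono:
  assumes "x \<le> y"
  shows "gev_cdf \<gamma> x \<le> gev_cdf \<gamma> y"
proof -
  consider "\<gamma> = 0" | "\<gamma> > 0" | "\<gamma> < 0" by linarith
  then show ?thesis
  proof cases
    case 1
    then show ?thesis using assms by (simp add: gev_cdf_def)
  next
    case 2
    then have "1 + \<gamma> * x \<le> 1 + \<gamma> * y" using assms by (simp add: mult_left_mono)
    show ?thesis
    proof (cases "1 + \<gamma> * x > 0")
      case True
      then have "1 + \<gamma> * y > 0"
        using \<open>1 + \<gamma> * x \<le> 1 + \<gamma> * y\<close> by linarith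
      then have "gev_cdf \<gamma> z = exp (- ((1 + \<gamma> * z) powr (- 1 / \<gamma>)))" if "z \<in> {x, y}" for z
        using 2 True that by (auto simp: gev_cdf_def)
      moreover have "(1 + \<gamma> * y) powr (- 1 / \<gamma>) \<le> (1 + \<gamma> * x) powr (- 1 / \<gamma>)"
        using 2 True \<open>1 + \<gamma> * x \<le> 1 + \<gamma> * y\<close> by (intro powr_mono2') auto
      ultimately show ?thesis
        by simp
    qed (use 2 in \<open>auto simp: gev_cdf_def\<close>)
  next
    case 3
    then have "1 + \<gamma> * y \<le> 1 + \<gamma> * x" using assms by (simp add: mult_left_mono_neg)
    show ?thesis
    proof (cases "1 + \<gamma> * y > 0")
      case True
      then have "1 + \<gamma> * x > 0"
        using \<open>1 + \<gamma> * y \<le> 1 + \<gamma> * x\<close> by linarith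
      then have "gev_cdf \<gamma> z = exp (- ((1 + \<gamma> * z) powr (- 1 / \<gamma>)))" if "z \<in> {x, y}" for z
        using 3 True that by (auto simp: gev_cdf_def)
      moreover have "(1 + \<gamma> * y) powr (- 1 / \<gamma>) \<le> (1 + \<gamma> * x) powr (- 1 / \<gamma>)"
        using 3 True \<open>1 + \<gamma> * y \<le> 1 + \<gamma> * x\<close> by (intro powr_mono2) (auto simp: divide_simps)
      ultimately show ?thesis
        by simp
    qed (use 3 in \<open>auto simp: gev_cdf_def\<close>)
  qed
qed

text \<open>
  For \<open>\<gamma> \<noteq> 0\<close> the only delicate point is the one with \<open>1 + \<gamma> * a = 0\<close>. For \<open>\<gamma> > 0\<close> it is the left
  endpoint of the support, where the limit from the right is taken along \<open>1 + \<gamma> * x\<close> decreasing to \<open>0\<close>;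
  for \<open>\<gamma> < 0\<close> it is the right endpoint, to the right of which the function is constantly \<open>1\<close>.
\<close>
lemma gev_cdf_right_continuous: "continuous (at_right a) (gev_cdf \<gamma>)"
proof -
  have lin: "((\<lambda>x. 1 + \<gamma> * x) \<longlongrightarrow> 1 + \<gamma> * a) (at_right a)"
    by (intro tendsto_intros)
  consider "\<gamma> = 0" | "\<gamma> \<noteq> 0" "1 + \<gamma> * a > 0" | "\<gamma> \<noteq> 0" "1 + \<gamma> * a < 0"
    | "\<gamma> > 0" "1 + \<gamma> * a = 0" | "\<gamma> < 0" "1 + \<gamma> * a = 0" by linarith
  then show ?thesis
  proof cases
    case 1
    then have "gev_cdf \<gamma> = (\<lambda>x. exp (- exp (- x)))"
      by (simp add: gev_cdf_def fun_eq_iff)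
    then show ?thesis by (simp add: continuous_intros)
  next
    case 2
    have "eventually (\<lambda>x. exp (- ((1 + \<gamma> * x) powr (- 1 / \<gamma>))) = gev_cdf \<gamma> x) (at_right a)"
      using order_tendstoD(1)[OF lin 2(2)] by eventually_elim (use 2 in \<open>simp add: gev_cdf_def\<close>)
    moreover have "((\<lambda>x. exp (- ((1 + \<gamma> * x) powr (- 1 / \<gamma>)))) \<longlongrightarrow> gev_cdf \<gamma> a) (at_right a)"
      using 2 by (auto simp: gev_cdf_def intro!: tendsto_eq_intros)
    ultimately show ?thesis
      unfolding continuous_within by (rule Lim_transform_eventually[rotated])
  next
    case 3
    have "eventually (\<lambda>x. gev_cdf \<gamma> a = gev_cdf \<gamma> x) (at_right a)"
      using order_tendstoD(2)[OF lin 3(2)] by eventually_elim (use 3 in \<open>simp add: gev_cdf_def\<close>)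
    then show ?thesis
      unfolding continuous_within by (rule Lim_transform_eventually[OF tendsto_const])
  next
    case 4
    define p where "p = 1 / \<gamma>"
    have "p > 0" using 4 by (simp add: p_def)
    then have lim: "((\<lambda>y. exp (- (y powr (- p)))) \<longlongrightarrow> 0) (at_right 0)"
      by real_asymp
    have pos: "eventually (\<lambda>x. 1 + \<gamma> * x > 0) (at_right a)"
      using eventually_at_right_less[of a]
    proof eventually_elim
      case (elim x)
      then have "\<gamma> * a < \<gamma> * x" using 4 by simp
      then show ?case using 4 by linarith
    qed
    have "filterlim (\<lambda>x. 1 + \<gamma> * x) (at_right 0) (at_right a)"
      using lin pos 4 by (auto simp: filterlim_at elim: eventually_mono)
    from filterlim_compose[OF lim this]
    have "((\<lambda>x. exp (- ((1 + \<gamma> * x) powr (- p)))) \<longlongrightarrow> gev_cdf \<gamma> a) (at_right a)"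
      using 4 by (simp add: gev_cdf_def)
    moreover have "eventually (\<lambda>x. exp (- ((1 + \<gamma> * x) powr (- p))) = gev_cdf \<gamma> x) (at_right a)"
      using pos by eventually_elim (use 4 in \<open>simp add: gev_cdf_def p_def\<close>)
    ultimately show ?thesis
      unfolding continuous_within by (rule Lim_transform_eventually)
  next
    case 5
    have "eventually (\<lambda>x. gev_cdf \<gamma> a = gev_cdf \<gamma> x) (at_right a)"
      using eventually_at_right_less[of a]
    proof eventually_elim
      case (elim x)
      then have "\<gamma> * x < \<gamma> * a" using 5 by simp
      then have "1 + \<gamma> * x < 0" using 5 by linarith
      then show ?case using 5 by (simp add: gev_cdf_def)
    qed
    then show ?thesis
      unfolding continuous_within by (rule Lim_transform_eventually[OF tendsto_const])
  qed
qed

text \<open>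
  In the proof the exponent \<open>- 1 / \<gamma>\<close> is replaced by a variable \<open>p\<close> of known sign, which is the form
  in which the asymptotics can be determined automatically.
\<close>
lemma gev_cdf_limits:
  "(gev_cdf \<gamma> \<longlongrightarrow> 0) at_bot" "(gev_cdf \<gamma> \<longlongrightarrow> 1) at_top"
proof -
  consider "\<gamma> = 0" | "\<gamma> > 0" | "\<gamma> < 0" by linarith
  then have "(gev_cdf \<gamma> \<longlongrightarrow> 0) at_bot \<and> (gev_cdf \<gamma> \<longlongrightarrow> 1) at_top"
  proof cases
    case 1
    have "((\<lambda>x::real. exp (- exp (- x))) \<longlongrightarrow> 0) at_bot" "((\<lambda>x::real. exp (- exp (- x))) \<longlongrightarrow> 1) at_top"
      by real_asymp+
    moreover have "gev_cdf \<gamma> = (\<lambda>x. exp (- exp (- x)))"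
      using 1 by (simp add: gev_cdf_def fun_eq_iff)
    ultimately show ?thesis by simp
  next
    case 2
    have "eventually (\<lambda>x. 0 = gev_cdf \<gamma> x) at_bot"
      using eventually_le_at_bot[of "- 1 / \<gamma>"]
      by eventually_elim (use 2 in \<open>auto simp: gev_cdf_def field_simps\<close>)
    then have 0: "(gev_cdf \<gamma> \<longlongrightarrow> 0) at_bot"
      by (rule Lim_transform_eventually[OF tendsto_const])
    have "p > 0 \<Longrightarrow> ((\<lambda>x. exp (- ((1 + \<gamma> * x) powr (- p)))) \<longlongrightarrow> 1) at_top" for p
      using 2 by real_asymp
    from this[of "1 / \<gamma>"] have "((\<lambda>x. exp (- ((1 + \<gamma> * x) powr (- 1 / \<gamma>)))) \<longlongrightarrow> 1) at_top"
      using 2 by simp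
    moreover have "eventually (\<lambda>x. exp (- ((1 + \<gamma> * x) powr (- 1 / \<gamma>))) = gev_cdf \<gamma> x) at_top"
      using eventually_ge_at_top[of 0]
      by eventually_elim (use 2 in \<open>auto simp: gev_cdf_def add_pos_nonneg\<close>)
    ultimately show ?thesis
      using 0 Lim_transform_eventually by blast
  next
    case 3
    have "eventually (\<lambda>x. 1 = gev_cdf \<gamma> x) at_top"
      using eventually_ge_at_top[of "- 1 / \<gamma>"]
      by eventually_elim (use 3 in \<open>auto simp: gev_cdf_def field_simps\<close>)
    then have 1: "(gev_cdf \<gamma> \<longlongrightarrow> 1) at_top"
      by (rule Lim_transform_eventually[OF tendsto_const])
    have "p > 0 \<Longrightarrow> ((\<lambda>x. exp (- ((1 + \<gamma> * x) powr p))) \<longlongrightarrow> 0) at_bot" for p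
      using 3 by real_asymp
    from this[of "- 1 / \<gamma>"] have "((\<lambda>x. exp (- ((1 + \<gamma> * x) powr (- 1 / \<gamma>)))) \<longlongrightarrow> 0) at_bot"
      using 3 by (simp add: divide_neg_neg)
    moreover have "eventually (\<lambda>x. exp (- ((1 + \<gamma> * x) powr (- 1 / \<gamma>))) = gev_cdf \<gamma> x) at_bot"
      using eventually_le_at_bot[of 0]
      by eventually_elim (use 3 in \<open>auto simp: gev_cdf_def add_pos_nonneg mult_nonpos_nonpos\<close>)
    ultimately show ?thesis
      using 1 Lim_transform_eventually by blast
  qed
  then show "(gev_cdf \<gamma> \<longlongrightarrow> 0) at_bot" "(gev_cdf \<gamma> \<longlongrightarrow> 1) at_top" by auto
qed

lemma prob_space_gev_measure: "prob_space (gev_measure \<gamma>)"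
  unfolding gev_measure_def
  using real_distribution_interval_measure[OF gev_cdf_mono gev_cdf_right_continuous gev_cdf_limits]
  by (simp add: real_distribution_def)

lemma sets_gev_measure [simp]: "sets (gev_measure \<gamma>) = sets borel"
  by (simp add: gev_measure_def)

text \<open>
  The point of the real line at which the distribution function equals \<open>exp (- exp (- L))\<close>. It is the
  image of \<open>L\<close> under the increasing map that carries the Gumbel distribution to the extreme value
  distribution with parameter \<open>\<gamma>\<close>, and the probability of exceeding it is about \<open>exp (- L)\<close>.
\<close>
definition gev_point :: "real \<Rightarrow> real \<Rightarrow> real" where
  "gev_point \<gamma> L = (if \<gamma> = 0 then L else (exp (\<gamma> * L) - 1) / \<gamma>)"

lemma gev_cdf_gev_point: "gev_cdf \<gamma> (gev_point \<gamma> L) = exp (- exp (- L))"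
  by (simp add: gev_cdf_def gev_point_def powr_def)

lemma gev_point_less:
  assumes "L < M"
  shows "gev_point \<gamma> L < gev_point \<gamma> M"
proof (rule ccontr)
  assume "\<not> ?thesis"
  then have "gev_cdf \<gamma> (gev_point \<gamma> M) \<le> gev_cdf \<gamma> (gev_point \<gamma> L)"
    by (intro gev_cdf_mono) simp
  then show False
    using assms by (simp add: gev_cdf_gev_point)
qed

lemma gev_point_mono: "L \<le> M \<Longrightarrow> gev_point \<gamma> L \<le> gev_point \<gamma> M"
  using gev_point_less[of L M \<gamma>] by (cases "L = M") auto

text \<open>The dyadic blocks of the scale \<open>L\<close>, transported to the real line.\<close>
definition gev_block :: "real \<Rightarrow> nat \<Rightarrow> real set" where
  "gev_block \<gamma> n = {gev_point \<gamma> (2 ^ n) <.. gev_point \<gamma> (2 ^ Suc n)}"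

lemma gev_block_borel [measurable]: "gev_block \<gamma> n \<in> sets borel"
  by (simp add: gev_block_def)

lemma disjoint_gev_blocks: "disjoint_family (gev_block \<gamma>)"
proof -
  have "gev_block \<gamma> m \<inter> gev_block \<gamma> n = {}" if "m < n" for m n
  proof -
    have "(2::real) ^ Suc m \<le> 2 ^ n"
      using that by (intro power_increasing) auto
    then have "gev_point \<gamma> (2 ^ Suc m) \<le> gev_point \<gamma> (2 ^ n)"
      by (rule gev_point_mono)
    then show ?thesis
      by (auto simp: gev_block_def)
  qed
  then show ?thesis
    unfolding disjoint_family_on_def by (metis inf_commute linorder_neqE_nat)
qed

lemma measure_gev_block_ge: "exp (- (2 ^ n + 2)) \<le> measure (gev_measure \<gamma>) (gev_block \<gamma> n)"
proof -
  define a b :: real where "a = exp (- (2 ^ n))" and "b = exp (- (2 ^ Suc n))"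
  have "emeasure (gev_measure \<gamma>) (gev_block \<gamma> n) = ennreal (exp (- b) - exp (- a))"
    unfolding gev_measure_def gev_block_def a_def b_def
    by (subst emeasure_interval_measure_Ioc)
       (auto intro!: gev_cdf_mono gev_cdf_right_continuous gev_point_mono simp: gev_cdf_gev_point)
  then have m: "measure (gev_measure \<gamma>) (gev_block \<gamma> n) = exp (- b) - exp (- a)"
    by (simp add: measure_def a_def b_def)
  have "1 \<le> (2::real) ^ n" by simp
  then have "a \<le> exp (- 1)" by (simp add: a_def)
  have e: "2 \<le> exp (1::real)" using exp_ge_add_one_self[of 1] by simp
  then have "exp (- 1) \<le> (1/2::real)" by (simp add: exp_minus field_simps)
  with \<open>a \<le> exp (- 1)\<close> have a: "a \<le> 1/2" "exp (- 1) \<le> 1 - a" by linarith+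
  have "0 < a" by (simp add: a_def)
  have b: "b = a * a" by (simp add: a_def b_def flip: exp_add)
  \<comment> \<open>the block has probability \<open>exp (- b) - exp (- a)\<close> with \<open>b = a\<^sup>2\<close>; the claim is \<open>a * exp (- 2)\<close>\<close>
  have "exp (- (2 ^ n + 2)) = exp (- 1) * (a * exp (- 1))"
    by (simp add: a_def flip: exp_add)
  also have "\<dots> \<le> exp (- a) * (a * (1 - a))"
    using a \<open>0 < a\<close> by (intro mult_mono) auto
  also have "\<dots> = exp (- a) * ((a - b + 1) - 1)"
    by (simp add: b algebra_simps)
  also have "\<dots> \<le> exp (- a) * (exp (a - b) - 1)"
    using exp_ge_add_one_self[of "a - b"] by (intro mult_left_mono) (linarith, rule exp_ge_zero)
  also have "\<dots> = exp (- b) - exp (- a)"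
    by (simp add: algebra_simps flip: exp_add)
  finally show ?thesis
    by (simp add: m)
qed

section \<open>Heavy tails at small divergence\<close>

text \<open>
  The bound in its sharp form: a level \<open>L\<close> on the scale of \<open>gev_point\<close> is exceeded with probability at
  least of order \<open>1 / (L * (ln L)\<^sup>2)\<close>. The mass is located in a single block beyond \<open>L\<close>, which for
  \<open>\<gamma> < 0\<close> keeps it strictly below the right endpoint.
\<close>
lemma exists_gev_neighbour_heavy_blocks:
  assumes "\<delta> > 0"
  shows "\<exists>P c. prob_space P \<and> sets P = sets borel \<and> absolutely_continuous (gev_measure \<gamma>) P \<and>
    KL_div P (gev_measure \<gamma>) \<le> ereal \<delta> \<and> 0 < c \<and>
    (\<forall>L\<ge>2. \<exists>n. L \<le> 2 ^ n \<and> c / (L * ln L ^ 2) \<le> measure P (gev_block \<gamma> n))"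
proof -
  let ?Q = "gev_measure \<gamma>"
  define v :: "nat \<Rightarrow> real" where "v n = 1 / (2 ^ n * real (Suc n) ^ 2)" for n
  have v0: "0 < v n" for n by (simp add: v_def)
  have sq: "summable (\<lambda>n. 1 / real (Suc n) ^ 2)"
    using inverse_power_summable[of 2, where ?'a = real]
    by (subst summable_Suc_iff) (simp add: field_simps)
  have "summable v"
  proof (rule summable_comparison_test[OF _ sq])
    have "v n \<le> 1 / real (Suc n) ^ 2" for n
      unfolding v_def by (intro divide_left_mono) auto
    then show "\<exists>N. \<forall>n\<ge>N. norm (v n) \<le> 1 / real (Suc n) ^ 2"
      using v0 by (auto simp: less_imp_le)
  qed
  define W where "W = suminf v"
  have "0 < W"
    unfolding W_def using \<open>summable v\<close> v0 by (rule suminf_pos)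
  define w where "w n = v n / W" for n
  have w0: "0 < w n" for n using v0 \<open>0 < W\<close> by (simp add: w_def)
  have w1: "w sums 1"
    using sums_divide[OF summable_sums[OF \<open>summable v\<close>], of W] \<open>0 < W\<close>
    by (simp add: w_def[abs_def] flip: W_def)
  have q: "0 < measure ?Q (gev_block \<gamma> n)" for n
    using measure_gev_block_ge[of n \<gamma>] by (smt (verit) exp_gt_zero)
  have summ: "summable (\<lambda>n. w n * ln (1 / measure ?Q (gev_block \<gamma> n)))"
  proof (rule summable_comparison_test[OF _ summable_mult[OF sq, of "3 / W"]], intro exI allI impI)
    fix n :: nat
    have "- (2 ^ n + 2) \<le> ln (measure ?Q (gev_block \<gamma> n))"
      using measure_gev_block_ge[of n \<gamma>] q[of n] by (simp add: ln_ge_iff)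
    then have "ln (1 / measure ?Q (gev_block \<gamma> n)) \<le> 2 ^ n + 2"
      using q[of n] by (simp add: ln_div)
    also have "\<dots> \<le> 3 * 2 ^ n" by simp
    finally have "w n * ln (1 / measure ?Q (gev_block \<gamma> n)) \<le> w n * (3 * 2 ^ n)"
      using w0[of n] by (intro mult_left_mono) auto
    also have "\<dots> = 3 / W * (1 / real (Suc n) ^ 2)"
      by (simp add: w_def v_def field_simps)
    finally have "w n * ln (1 / measure ?Q (gev_block \<gamma> n)) \<le> 3 / W * (1 / real (Suc n) ^ 2)" .
    moreover have "0 \<le> w n * ln (1 / measure ?Q (gev_block \<gamma> n))"
      using w0[of n] q[of n] prob_space.prob_le_1[OF prob_space_gev_measure]
      by (intro mult_nonneg_nonneg) auto
    ultimately show "norm (w n * ln (1 / measure ?Q (gev_block \<gamma> n))) \<le> 3 / W * (1 / real (Suc n) ^ 2)"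
      by simp
  qed
  obtain P \<eta> where P: "prob_space P" "sets P = sets borel" "absolutely_continuous ?Q P"
    "KL_div P ?Q \<le> ereal \<delta>" and "0 < \<eta>" and Pw: "\<And>n. \<eta> * w n \<le> measure P (gev_block \<gamma> n)"
    using exists_close_measure_with_weights[OF prob_space_gev_measure sets_gev_measure
        disjoint_gev_blocks gev_block_borel q less_imp_le[OF w0] w1 summ assms] by blast
  \<comment> \<open>below, \<open>2 ^ n \<le> 2 * L\<close> and \<open>n + 1 \<le> 7 * ln L\<close>; \<open>100\<close> exceeds \<open>2 * 7\<^sup>2\<close>\<close>
  define c where "c = \<eta> / (W * 100)"
  have "0 < c" using \<open>0 < \<eta>\<close> \<open>0 < W\<close> by (simp add: c_def)
  moreover have "\<exists>n. L \<le> 2 ^ n \<and> c / (L * ln L ^ 2) \<le> measure P (gev_block \<gamma> n)" if "2 \<le> L" for L :: real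
  proof -
    define n where "n = (LEAST n. L \<le> 2 ^ n)"
    have "\<exists>n. L \<le> 2 ^ n"
      using real_arch_pow[of 2 L] by (auto intro: less_imp_le)
    then have Ln: "L \<le> 2 ^ n"
      unfolding n_def by (rule LeastI_ex)
    have "n \<noteq> 0" using Ln that by (intro notI) simp
    then obtain k where k: "n = Suc k" using not0_implies_Suc by blast
    then have "\<not> L \<le> 2 ^ k"
      using not_less_Least[of k "\<lambda>n. L \<le> 2 ^ n"] by (simp add: n_def[symmetric])
    then have kL: "2 ^ k \<le> L" by simp
    have "2 ^ n \<le> 2 * L" using kL k by simp
    have ln2: "1/2 \<le> ln (2::real)"
      using ln2_ge_two_thirds by simp
    have lnL: "ln 2 \<le> ln L" using that by simp
    have "real k * ln 2 \<le> ln L"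
      using kL that by (metis ln_le_cancel_iff ln_realpow less_le_trans zero_less_numeral zero_less_power)
    moreover have "real k * (1/2) \<le> real k * ln 2"
      using ln2 by (intro mult_left_mono) auto
    ultimately have "real (Suc n) \<le> 7 * ln L"
      using k ln2 lnL by simp
    then have "real (Suc n) ^ 2 \<le> (7 * ln L) ^ 2"
      by (intro power_mono) auto
    also have "\<dots> \<le> 50 * ln L ^ 2"
      by (simp add: power_mult_distrib)
    finally have "2 ^ n * real (Suc n) ^ 2 \<le> (2 * L) * (50 * ln L ^ 2)"
      using \<open>2 ^ n \<le> 2 * L\<close> that by (intro mult_mono) auto
    then have le: "1 / ((2 * L) * (50 * ln L ^ 2)) \<le> v n"
      unfolding v_def by (intro divide_left_mono) (use that in \<open>auto intro!: mult_pos_pos\<close>)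
    have "c / (L * ln L ^ 2) \<le> \<eta> * w n"
      using mult_left_mono[OF le, of "\<eta> / W"] \<open>0 < \<eta>\<close> \<open>0 < W\<close> by (simp add: c_def w_def)
    then show ?thesis
      using Ln Pw[of n] by (meson order_trans)
  qed
  ultimately show ?thesis
    using P by blast
qed

lemma right_endpoint_gev_cdf:
  assumes "\<gamma> < 0"
  shows "right_endpoint (gev_cdf \<gamma>) = ereal (- 1 / \<gamma>)"
proof -
  have "{x. gev_cdf \<gamma> x < 1} = {..< - 1 / \<gamma>}"
    using assms by (auto simp: gev_cdf_def field_simps split: if_splits)
  moreover have "(SUP x\<in>{..< - 1 / \<gamma>}. ereal x) = ereal (- 1 / \<gamma>)"
  proof (rule antisym)
    show "ereal (- 1 / \<gamma>) \<le> (SUP x\<in>{..< - 1 / \<gamma>}. ereal x)"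
    proof (rule dense_le)
      fix y assume "y < ereal (- 1 / \<gamma>)"
      then obtain z where "y < ereal z" "ereal z < ereal (- 1 / \<gamma>)"
        using ereal_dense2 by blast
      then show "y \<le> (SUP x\<in>{..< - 1 / \<gamma>}. ereal x)"
        by (intro SUP_upper2[of z]) auto
    qed
  qed (auto intro!: SUP_least)
  ultimately show ?thesis
    by (simp add: right_endpoint_def)
qed

lemma gev_point_less_endpoint:
  assumes "\<gamma> < 0"
  shows "gev_point \<gamma> L < - 1 / \<gamma>"
  using assms by (simp add: gev_point_def divide_simps)

text \<open>
  The distribution function takes values arbitrarily close to \<open>1\<close> strictly below the endpoint, so the
  endpoint itself carries no mass.
\<close>
lemma gev_measure_below_endpoint:
  assumes "\<gamma> < 0"
  shows "measure (gev_measure \<gamma>) {..< - 1 / \<gamma>} = 1"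
proof -
  interpret prob_space "gev_measure \<gamma>"
    by (rule prob_space_gev_measure)
  have "exp (- exp (- L)) \<le> prob {..< - 1 / \<gamma>}" for L
  proof -
    have "prob {..gev_point \<gamma> L} = exp (- exp (- L))"
      unfolding gev_measure_def
      by (subst measure_interval_measure_Iic)
         (auto intro: gev_cdf_mono gev_cdf_right_continuous gev_cdf_limits simp: gev_cdf_gev_point)
    moreover have "prob {..gev_point \<gamma> L} \<le> prob {..< - 1 / \<gamma>}"
      using gev_point_less_endpoint[OF assms, of L] by (intro finite_measure_mono) auto
    ultimately show ?thesis
      by simp
  qed
  moreover have "((\<lambda>L::real. exp (- exp (- L))) \<longlongrightarrow> 1) at_top"
    by real_asymp
  ultimately have "1 \<le> prob {..< - 1 / \<gamma>}"
    by (intro tendsto_upperbound) (auto intro!: always_eventually)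
  then show ?thesis
    using prob_le_1 by (simp add: antisym)
qed

lemma prob_eq_1_absolutely_continuous:
  assumes "prob_space Q" "prob_space P" "sets P = sets Q" "absolutely_continuous Q P"
    and "A \<in> sets Q" "measure Q A = 1"
  shows "measure P A = 1"
proof -
  interpret Q: prob_space Q by fact
  interpret P: prob_space P by fact
  have "AE x in Q. x \<in> A"
    using assms by (simp add: Q.prob_eq_1)
  then have "AE x in P. x \<in> A"
    using assms by (intro absolutely_continuous_AE[of P Q])
  then show ?thesis
    using assms by (simp add: P.prob_eq_1)
qed

lemma inverse_cube_le:
  fixes L :: real
  assumes "2 \<le> L" "0 \<le> c"
  shows "c / L ^ 3 \<le> c / (L * ln L ^ 2)"
proof -
  have "ln L \<le> L" using ln_le_minus_one[of L] assms by simp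
  then have "L * ln L ^ 2 \<le> L * L ^ 2"
    using assms by (intro mult_left_mono power_mono) auto
  moreover have "0 < L * ln L ^ 2"
    using assms by simp
  ultimately show ?thesis
    using assms by (intro divide_left_mono) (auto simp: power2_eq_square power3_eq_cube)
qed

theorem proposition9:
  fixes \<gamma>_ref \<delta> :: real
  assumes "\<delta> > 0"
  shows "\<exists>P :: real measure. prob_space P \<and> sets P = sets borel \<and>
    KL_div P (gev_measure \<gamma>_ref) \<le> ereal \<delta> \<and>
    (\<gamma>_ref > 0 \<longrightarrow>
      (\<exists>c_plus > 0. \<exists>x_plus > 0. \<forall>x > x_plus.
         measure P {x<..} \<ge> c_plus * ln x powi (-3))) \<and>
    (\<gamma>_ref = 0 \<longrightarrow>
      (\<exists>c_0 > 0. \<exists>x_0 > 0. \<forall>x > x_0.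
         measure P {x<..} \<ge> c_0 * x powi (-1) * ln x powi (-2))) \<and>
    (\<gamma>_ref < 0 \<longrightarrow>
      (\<exists>x_G :: real. ereal x_G = right_endpoint (gev_cdf \<gamma>_ref) \<and>
         measure P {..<x_G} = 1 \<and>
         (\<exists>c_minus > 0. \<exists>eps_minus > 0. \<forall>\<epsilon>. 0 < \<epsilon> \<and> \<epsilon> < eps_minus \<longrightarrow>
            measure P {x_G - \<epsilon><..<x_G} \<ge> c_minus * ln (1 / \<epsilon>) powi (-3))))"
proof -
  let ?Q = "gev_measure \<gamma>_ref"
  obtain P c where P: "prob_space P" "sets P = sets borel" "absolutely_continuous ?Q P"
    "KL_div P ?Q \<le> ereal \<delta>" and "0 < c"
    and tail: "\<And>L. 2 \<le> L \<Longrightarrow> \<exists>n. L \<le> 2 ^ n \<and> c / (L * ln L ^ 2) \<le> measure P (gev_block \<gamma>_ref n)"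
    using exists_gev_neighbour_heavy_blocks[OF assms, of \<gamma>_ref] by blast
  interpret P: prob_space P by fact
  have tail_ge: "c / (L * ln L ^ 2) \<le> measure P B"
    if "2 \<le> L" "B \<in> sets borel" and B: "\<And>n. L \<le> 2 ^ n \<Longrightarrow> gev_block \<gamma>_ref n \<subseteq> B" for L B
  proof -
    obtain n where "L \<le> 2 ^ n" "c / (L * ln L ^ 2) \<le> measure P (gev_block \<gamma>_ref n)"
      using tail[OF \<open>2 \<le> L\<close>] by blast
    moreover have "measure P (gev_block \<gamma>_ref n) \<le> measure P B"
      using B[OF \<open>L \<le> 2 ^ n\<close>] that P(2) by (intro P.finite_measure_mono) auto
    ultimately show ?thesis by linarith
  qed
  have tail_upper: "c / (L * ln L ^ 2) \<le> measure P {x<..}" if "2 \<le> L" "x \<le> gev_point \<gamma>_ref L" for x L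
  proof (rule tail_ge[OF that(1)])
    fix n assume "L \<le> 2 ^ n"
    from gev_point_mono[OF this, of \<gamma>_ref] that(2) show "gev_block \<gamma>_ref n \<subseteq> {x<..}"
      by (auto simp: gev_block_def)
  qed simp

  have pos_case: "\<exists>c_plus > 0. \<exists>x_plus > 0. \<forall>x > x_plus. measure P {x<..} \<ge> c_plus * ln x powi (-3)"
    if g: "\<gamma>_ref > 0"
  proof (intro exI conjI allI impI)
    fix x assume x: "x > exp \<gamma>_ref"
    \<comment> \<open>with this choice \<open>gev_point \<gamma>_ref L = (x\<^sup>2 - 1) / \<gamma>_ref\<close>, which exceeds \<open>x\<close> for large \<open>x\<close>\<close>
    define L where "L = 2 / \<gamma>_ref * ln x"
    have "0 < x" using x exp_gt_zero by (rule less_trans[rotated])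
    have "\<gamma>_ref < ln x" using x \<open>0 < x\<close> by (metis exp_less_cancel_iff exp_ln)
    then have "2 \<le> L" using g by (simp add: L_def field_simps)
    have "1 + \<gamma>_ref < x" using x exp_ge_add_one_self[of \<gamma>_ref] by linarith
    then have "1 * 1 \<le> x * (x - \<gamma>_ref)" using g by (intro mult_mono) auto
    moreover have "exp (\<gamma>_ref * L) = x * x"
    proof -
      have "\<gamma>_ref * L = ln x + ln x" using g by (simp add: L_def)
      then show ?thesis using \<open>0 < x\<close> by (simp only: exp_add exp_ln)
    qed
    ultimately have "x \<le> gev_point \<gamma>_ref L"
      using g by (simp add: gev_point_def field_simps)
    then have "c / L ^ 3 \<le> measure P {x<..}"
      using tail_upper[OF \<open>2 \<le> L\<close>] inverse_cube_le[OF \<open>2 \<le> L\<close>, of c] \<open>0 < c\<close> by fastforce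
    then show "measure P {x<..} \<ge> c * (\<gamma>_ref / 2) ^ 3 * ln x powi (-3)"
      using g by (simp add: L_def power_int_minus power_mult_distrib power_divide field_simps)
  qed (use g \<open>0 < c\<close> in auto)

  have zero_case: "\<exists>c_0 > 0. \<exists>x_0 > 0. \<forall>x > x_0. measure P {x<..} \<ge> c_0 * x powi (-1) * ln x powi (-2)"
    if g: "\<gamma>_ref = 0"
  proof (intro exI conjI allI impI)
    fix x :: real assume "x > 2"
    then have "c / (x * ln x ^ 2) \<le> measure P {x<..}"
      using g by (intro tail_upper) (auto simp: gev_point_def)
    then show "measure P {x<..} \<ge> c * x powi (-1) * ln x powi (-2)"
      by (simp add: power_int_minus divide_simps)
  qed (use \<open>0 < c\<close> in auto)

  have neg_case: "\<exists>x_G :: real. ereal x_G = right_endpoint (gev_cdf \<gamma>_ref) \<and>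
         measure P {..<x_G} = 1 \<and>
         (\<exists>c_minus > 0. \<exists>eps_minus > 0. \<forall>\<epsilon>. 0 < \<epsilon> \<and> \<epsilon> < eps_minus \<longrightarrow>
            measure P {x_G - \<epsilon><..<x_G} \<ge> c_minus * ln (1 / \<epsilon>) powi (-3))"
    if g: "\<gamma>_ref < 0"
  proof (rule exI[of _ "- 1 / \<gamma>_ref"], intro conjI)
    show "ereal (- 1 / \<gamma>_ref) = right_endpoint (gev_cdf \<gamma>_ref)"
      using right_endpoint_gev_cdf[OF g] by simp
    show "measure P {..< - 1 / \<gamma>_ref} = 1"
      by (rule prob_eq_1_absolutely_continuous[OF prob_space_gev_measure P(1) _ P(3) _
            gev_measure_below_endpoint[OF g]]) (simp_all add: P(2))
    define h where "h = - \<gamma>_ref"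
    have h: "0 < h" "\<gamma>_ref = - h" using g by (auto simp: h_def)
    show "\<exists>c_minus > 0. \<exists>eps_minus > 0. \<forall>\<epsilon>. 0 < \<epsilon> \<and> \<epsilon> < eps_minus \<longrightarrow>
            measure P {- 1 / \<gamma>_ref - \<epsilon><..< - 1 / \<gamma>_ref} \<ge> c_minus * ln (1 / \<epsilon>) powi (-3)"
    proof (intro exI conjI allI impI)
      fix \<epsilon> assume eps: "0 < \<epsilon> \<and> \<epsilon> < min h (exp (- h))"
      \<comment> \<open>with this choice the distance from \<open>gev_point \<gamma>_ref L\<close> to the endpoint is \<open>\<epsilon>\<^sup>2 / h \<le> \<epsilon>\<close>\<close>
      define L where "L = 2 / h * ln (1 / \<epsilon>)"
      have "ln \<epsilon> < - h"
        using eps by (metis exp_less_cancel_iff exp_ln min_less_iff_conj)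
      then have ln: "h < ln (1 / \<epsilon>)" using eps by (simp add: ln_div)
      then have "2 \<le> L" using h by (simp add: L_def field_simps)
      have "exp (- (h * L)) = \<epsilon> * \<epsilon>"
      proof -
        have "- (h * L) = ln \<epsilon> + ln \<epsilon>" using h eps by (simp add: L_def ln_div)
        then show ?thesis using eps by (simp only: exp_add exp_ln)
      qed
      then have "gev_point \<gamma>_ref L = - 1 / \<gamma>_ref - \<epsilon> * \<epsilon> / h"
        using h by (simp add: gev_point_def diff_divide_distrib)
      moreover have "\<epsilon> * \<epsilon> \<le> \<epsilon> * h"
        using eps by (intro mult_left_mono) auto
      ultimately have le: "- 1 / \<gamma>_ref - \<epsilon> \<le> gev_point \<gamma>_ref L"
        using h by (simp add: pos_divide_le_eq)
      have "c / (L * ln L ^ 2) \<le> measure P {- 1 / \<gamma>_ref - \<epsilon><..< - 1 / \<gamma>_ref}"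
      proof (rule tail_ge[OF \<open>2 \<le> L\<close>])
        fix n assume "L \<le> 2 ^ n"
        from gev_point_mono[OF this, of \<gamma>_ref] le gev_point_less_endpoint[OF g, of "2 ^ Suc n"]
        show "gev_block \<gamma>_ref n \<subseteq> {- 1 / \<gamma>_ref - \<epsilon><..< - 1 / \<gamma>_ref}"
          unfolding gev_block_def by auto
      qed simp
      then have "c / L ^ 3 \<le> measure P {- 1 / \<gamma>_ref - \<epsilon><..< - 1 / \<gamma>_ref}"
        using inverse_cube_le[OF \<open>2 \<le> L\<close>, of c] \<open>0 < c\<close> by linarith
      moreover have "c / L ^ 3 = c * (h / 2) ^ 3 * ln (1 / \<epsilon>) powi (-3)"
        using h ln by (simp add: L_def power_int_minus power_mult_distrib power_divide field_simps)
      ultimately show "measure P {- 1 / \<gamma>_ref - \<epsilon><..< - 1 / \<gamma>_ref} \<ge> c * (h / 2) ^ 3 * ln (1 / \<epsilon>) powi (-3)"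
        by simp
    qed (use h \<open>0 < c\<close> in auto)
  qed
  show ?thesis
    using P pos_case zero_case neg_case by blast
qed

end
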